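(* Let $A=[\xi_{ij}]_{n\times n}\in\mathbb{C}_2^{n\times n}$ be a bicomplex matrix with $\rho(A)=n$. Then $\rho(A)=\rho_c(A)=\rho_r(A)$.
   Context: $\mathbb{C}_1$ denotes the complex numbers (imaginary unit $i_1$). $\mathbb{C}_2=\{z_1+i_2z_2: z_1,z_2\in\mathbb{C}_1\}$ is the commutative ring of bicomplex numbers, where $i_1i_2=i_2i_1$, $i_1^2=i_2^2=-1$. Put $e_1=\frac{1+i_1i_2}{2}$, $e_2=\frac{1-i_1i_2}{2}$; every $\xi\in\mathbb{C}_2$ is uniquely $\xi=1_\xi e_1+2_\xi e_2$ with $1_\xi,2_\xi\in\mathbb{C}_1$, and operations are component-wise in this representation. $O_2$ is the set of non-invertible elements of $\mathbb{C}_2$ (including $0$). A square bicomplex matrix $B$ is non-singular if $\det(B)\notin O_2$. Rank: write $B\preccurlyeq C$ if $B$ is a sub-matrix of $C$ (obtained by omitting some, possibly no, rows and columns). For $A\in\mathbb{C}_2^{n\times m}$, $\rho(A)$ is the number $r\ge 1$ such that (i) there is a chain $B_1\preccurlyeq B_2\preccurlyeq\cdots\preccurlyeq B_r\preccurlyeq A$ in which each $B_i$ is a non-singular $i\times i$ sub-matrix; and (ii) no such chain $B_1\preccurlyeq\cdots\preccurlyeq B_t=B'$ exists for any $t\times t$ sub-matrix $B'$ of $A$ with $t>r$. If no such $r$ exists, $\rho(A)=0$. Row rank $\rho_r(A)$: the dimension over $\mathbb{C}_1$ of the $\mathbb{C}_1$-subspace of $\mathbb{C}_2^m$ spanned (with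 scalars in $\mathbb{C}_1$) by the rows of $A$. Column rank $\rho_c(A)$: the dimension over $\mathbb{C}_1$ of the $\mathbb{C}_1$-subspace of $\mathbb{C}_2^n$ spanned by the columns of $A$. *)

theory Defs
  imports
    "HOL.Complex"
    "Jordan_Normal_Form.Determinant"
    "Jordan_Normal_Form.DL_Submatrix"
    "Jordan_Normal_Form.VS_Connect"
begin

(* Bicomplex z1 z2 stands for z1 + i2 z2; see Bicomplex_eq below. *)
datatype bicomplex = Bicomplex (bc_fst: complex) (bc_snd: complex)

lemma bicomplex_eq_iff: "x = y \<longleftrightarrow> bc_fst x = bc_fst y \<and> bc_snd x = bc_snd y"
  by (cases x; cases y) auto

instantiation bicomplex :: comm_ring_1
begin

definition zero_bicomplex :: bicomplex where
  "0 = Bicomplex 0 0"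

definition one_bicomplex :: bicomplex where
  "1 = Bicomplex 1 0"

definition plus_bicomplex :: "bicomplex \<Rightarrow> bicomplex \<Rightarrow> bicomplex" where
  "x + y = Bicomplex (bc_fst x + bc_fst y) (bc_snd x + bc_snd y)"

definition minus_bicomplex :: "bicomplex \<Rightarrow> bicomplex \<Rightarrow> bicomplex" where
  "x - y = Bicomplex (bc_fst x - bc_fst y) (bc_snd x - bc_snd y)"

definition uminus_bicomplex :: "bicomplex \<Rightarrow> bicomplex" where
  "- x = Bicomplex (- bc_fst x) (- bc_snd x)"

definition times_bicomplex :: "bicomplex \<Rightarrow> bicomplex \<Rightarrow> bicomplex" where
  "x * y = Bicomplex (bc_fst x * bc_fst y - bc_snd x * bc_snd y)
                     (bc_fst x * bc_snd y + bc_snd x * bc_fst y)"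

instance
  by standard
    (simp_all add: bicomplex_eq_iff zero_bicomplex_def one_bicomplex_def plus_bicomplex_def
      minus_bicomplex_def uminus_bicomplex_def times_bicomplex_def algebra_simps)

end

definition bc_of_complex :: "complex \<Rightarrow> bicomplex" where
  "bc_of_complex z = Bicomplex z 0"

definition bc_i2 :: bicomplex where
  "bc_i2 = Bicomplex 0 1"

lemma bc_i2_squared: "bc_i2 * bc_i2 = -1"
  by (simp add: bc_i2_def times_bicomplex_def uminus_bicomplex_def one_bicomplex_def)

lemma Bicomplex_eq: "Bicomplex z w = bc_of_complex z + bc_i2 * bc_of_complex w"
  by (simp add: bc_i2_def bc_of_complex_def times_bicomplex_def plus_bicomplex_def)

lemma bc_of_complex_hom:
  "bc_of_complex 0 = 0" "bc_of_complex 1 = 1"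
  "bc_of_complex (z + w) = bc_of_complex z + bc_of_complex w"
  "bc_of_complex (z * w) = bc_of_complex z * bc_of_complex w"
  by (simp_all add: bc_of_complex_def zero_bicomplex_def one_bicomplex_def
      plus_bicomplex_def times_bicomplex_def)

definition O2 :: "bicomplex set" where
  "O2 = {\<xi>. \<not> \<xi> dvd 1}"

definition nonsingular_mat :: "bicomplex mat \<Rightarrow> bool" where
  "nonsingular_mat B \<longleftrightarrow> square_mat B \<and> det B \<notin> O2"

definition is_submatrix :: "'a mat \<Rightarrow> 'a mat \<Rightarrow> bool" where
  "is_submatrix B C \<longleftrightarrow> (\<exists>I J. B = submatrix C I J)"

definition nonsingular_chain :: "bicomplex mat \<Rightarrow> nat \<Rightarrow> (nat \<Rightarrow> bicomplex mat) \<Rightarrow> bool" where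
  "nonsingular_chain A r B \<longleftrightarrow>
     (\<forall>i\<in>{1..r}. B i \<in> carrier_mat i i \<and> nonsingular_mat (B i)) \<and>
     (\<forall>i\<in>{1..<r}. is_submatrix (B i) (B (Suc i))) \<and>
     is_submatrix (B r) A"

definition is_bc_rank :: "bicomplex mat \<Rightarrow> nat \<Rightarrow> bool" where
  "is_bc_rank A r \<longleftrightarrow> r \<ge> 1 \<and> (\<exists>B. nonsingular_chain A r B) \<and>
     (\<forall>t>r. \<nexists>B. nonsingular_chain A t B)"

lemma is_bc_rank_unique: "is_bc_rank A r \<Longrightarrow> is_bc_rank A s \<Longrightarrow> r = s"
  unfolding is_bc_rank_def by (metis linorder_neqE_nat)

definition bc_rank :: "bicomplex mat \<Rightarrow> nat" where
  "bc_rank A = (if \<exists>r. is_bc_rank A r then THE r. is_bc_rank A r else 0)"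

(* The bicomplex n-vectors as a vector space over the complex numbers only: the library's
   module_vec would take the scalars from the bicomplex numbers. *)
definition bc_vec_space :: "nat \<Rightarrow> (complex, bicomplex vec) module" where
  "bc_vec_space n = \<lparr>
    carrier = carrier_vec n,
    mult = undefined,
    one = undefined,
    zero = 0\<^sub>v n,
    add = (+),
    smult = (\<lambda>c v. bc_of_complex c \<cdot>\<^sub>v v)\<rparr>"

lemma vectorspace_bc_vec_space: "vectorspace class_ring (bc_vec_space n)"
proof -
  have "abelian_group (bc_vec_space n)"
  proof (rule abelian_groupI)
    fix x assume "x \<in> carrier (bc_vec_space n)"
    then show "\<exists>y\<in>carrier (bc_vec_space n). y \<oplus>\<^bsub>bc_vec_space n\<^esub> x = \<zero>\<^bsub>bc_vec_space n\<^esub>"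
      by (intro bexI[of _ "- x"]) (auto simp: bc_vec_space_def)
  qed (auto simp: bc_vec_space_def intro: comm_add_vec assoc_add_vec)
  then have "Module.module (class_ring :: complex ring) (bc_vec_space n)"
  proof (rule module.intro[OF field.axioms(1)[OF class_field, THEN domain.axioms(1)]])
    show "module_axioms (class_ring :: complex ring) (bc_vec_space n)"
      by unfold_locales
        (auto simp: bc_vec_space_def bc_of_complex_hom add_smult_distrib_vec
          smult_add_distrib_vec smult_smult_assoc)
  qed
  then show ?thesis
    by (intro vectorspace.intro class_field)
qed

definition bc_span_dim :: "nat \<Rightarrow> bicomplex vec set \<Rightarrow> nat" where
  "bc_span_dim n S =
     vectorspace.dim class_ring
       (bc_vec_space n\<lparr>carrier := LinearCombinations.module.span class_ring (bc_vec_space n) S\<rparr>)"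

definition row_rank :: "bicomplex mat \<Rightarrow> nat" where
  "row_rank A = bc_span_dim (dim_col A) (set (rows A))"

definition col_rank :: "bicomplex mat \<Rightarrow> nat" where
  "col_rank A = bc_span_dim (dim_row A) (set (cols A))"

end

theory Submission
  imports Defs "Jordan_Normal_Form.DL_Rank"
begin

text \<open>An \<open>n \<times> n\<close> sub-matrix of an \<open>n \<times> n\<close> matrix is the matrix itself, so \<open>\<rho>(A) = n\<close> forces
  \<open>det A\<close> to be invertible. Multiplying by the adjugate shows that the columns of \<open>A\<close> are then
  independent over the bicomplex numbers, a fortiori over the complex numbers, and the same
  applies to the transpose.\<close>

text \<open>By \<open>pick_card_in_set\<close>, an element of \<open>I\<close> is picked at the
  position that counts the smaller elements of \<open>I\<close>; here these are exactly the numbers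
  below \<open>i\<close>.\<close>

lemma pick_initial_segment:
  assumes "{..<n} \<subseteq> I" and "i < n"
  shows "pick I i = i"
proof -
  have "{a \<in> I. a < i} = {..<i}"
    using assms by auto
  with pick_card_in_set[of i I] assms show ?thesis
    by auto
qed

text \<open>The dimensions of a sub-matrix count the selected indices within range, so equal
  dimensions mean that all of them are selected. \<open>I\<close> and \<open>J\<close> may also
  contain indices out of range, hence inclusions instead of equalities.\<close>

lemma submatrix_same_dim:
  assumes "dim_row (submatrix A I J) = dim_row A" and "dim_col (submatrix A I J) = dim_col A"
  shows "submatrix A I J = A"
proof -
  have full: "{..<m} \<subseteq> K" if "card {k. k < m \<and> k \<in> K} = m" for m :: nat and K
  proof -
    have "{k. k < m \<and> k \<in> K} = {..<m}"
      by (rule card_subset_eq) (use that in auto)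
    then show ?thesis
      by auto
  qed
  have "{..<dim_row A} \<subseteq> I" "{..<dim_col A} \<subseteq> J"
    using assms full by (simp_all add: dim_submatrix)
  then show ?thesis
    using assms
    by (intro eq_matI) (simp_all add: submatrix_index dim_submatrix pick_initial_segment)
qed

lemma bc_rank_full_imp_det_dvd_one:
  assumes "A \<in> carrier_mat n n" and "bc_rank A = n"
  shows "det A dvd 1"
proof (cases "n = 0")
  \<comment> \<open>The value 0 of \<open>bc_rank\<close> may be the default and then gives no
    chain; but the determinant of the empty matrix is 1.\<close>
  case True
  with assms show ?thesis
    by simp
next
  case False
  with assms(2) obtain r where r: "is_bc_rank A r"
    by (auto simp: bc_rank_def split: if_splits)
  then have "bc_rank A = r"
    using is_bc_rank_unique by (auto simp: bc_rank_def)
  with r assms(2) have "is_bc_rank A n"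
    by simp
  then obtain B where "nonsingular_chain A n B"
    by (auto simp: is_bc_rank_def)
  with False have B: "B n \<in> carrier_mat n n" "nonsingular_mat (B n)" "is_submatrix (B n) A"
    by (auto simp: nonsingular_chain_def)
  with assms(1) have "B n = A"
    by (auto simp: is_submatrix_def intro!: submatrix_same_dim)
  with B(2) show ?thesis
    by (simp add: nonsingular_mat_def O2_def)
qed

lemma smult_mat_mult_vec:
  fixes A :: "'a :: comm_ring_1 mat"
  assumes "x \<in> carrier_vec (dim_col A)"
  shows "(k \<cdot>\<^sub>m A) *\<^sub>v x = k \<cdot>\<^sub>v (A *\<^sub>v x)"
  using assms by (intro eq_vecI) auto

lemma mult_mat_vec_eq_zero_imp_zero:
  fixes A :: "'a :: comm_ring_1 mat"
  assumes A: "A \<in> carrier_mat n n" and unit: "det A dvd 1"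
    and x: "x \<in> carrier_vec n" and zero: "A *\<^sub>v x = 0\<^sub>v n"
  shows "x = 0\<^sub>v n"
proof -
  from unit obtain d where d: "1 = det A * d" ..
  have "(adj_mat A * A) *\<^sub>v x = adj_mat A *\<^sub>v (A *\<^sub>v x)"
    using A x adj_mat(1) by (intro assoc_mult_mat_vec) auto
  also have "\<dots> = 0\<^sub>v n"
    using adj_mat(1)[OF A] zero by auto
  finally have "det A \<cdot>\<^sub>v x = 0\<^sub>v n"
    using x by (simp add: adj_mat(3)[OF A] smult_mat_mult_vec)
  \<comment> \<open>With zero divisors around, \<open>det A\<close> cannot be cancelled merely for
    being nonzero; its inverse \<open>d\<close> removes it.\<close>
  then have "d \<cdot>\<^sub>v (det A \<cdot>\<^sub>v x) = 0\<^sub>v n"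
    by auto
  with d show ?thesis
    by (simp add: smult_smult_assoc mult.commute)
qed

text \<open>Equal columns would make the determinant 0, which is no unit. Distinctness matters
  because the column rank is defined from the set of columns, where repetitions collapse.\<close>

lemma distinct_cols_if_det_dvd_one:
  fixes A :: "'a :: comm_ring_1 mat"
  assumes A: "A \<in> carrier_mat n n" and unit: "det A dvd 1"
  shows "distinct (cols A)"
proof -
  have "det A \<noteq> 0"
    using unit by auto
  with A show ?thesis
    using det_identical_columns[OF A] by (fastforce simp: distinct_conv_nth)
qed

interpretation bc: vectorspace class_ring "bc_vec_space n" for n
  by (rule vectorspace_bc_vec_space)

lemma bc_vec_space_simps [simp]:
  "carrier (bc_vec_space n) = carrier_vec n"
  "zero (bc_vec_space n) = 0\<^sub>v n"
  "add (bc_vec_space n) = (+)"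
  "module.smult (bc_vec_space n) c v = bc_of_complex c \<cdot>\<^sub>v v"
  by (simp_all add: bc_vec_space_def)

lemma bc_lincomb_index:
  assumes "finite S" and "S \<subseteq> carrier_vec n" and "i < n"
  shows "bc.lincomb n a S $ i = (\<Sum>v\<in>S. bc_of_complex (a v) * v $ i)"
  using assms
proof (induction S)
  case empty
  then show ?case
    by (simp add: bc.lincomb_def)
next
  case (insert v S)
  have "bc.lincomb n a (insert v S) = bc_of_complex (a v) \<cdot>\<^sub>v v + bc.lincomb n a S"
    unfolding bc.lincomb_def using insert by (subst bc.finsum_insert) auto
  moreover have "bc.lincomb n a S \<in> carrier_vec n"
    using insert bc.lincomb_closed[of S n a] by auto
  ultimately show ?case
    using insert by auto
qed

lemma bc_lin_indpt_cols:
  assumes A: "A \<in> carrier_mat n n" and unit: "det A dvd 1"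
  shows "bc.lin_indpt n (set (cols A))"
proof (rule bc.finite_lin_indpt2)
  show carr: "set (cols A) \<subseteq> carrier (bc_vec_space n)"
    using A cols_dim[of A] by auto
  fix a :: "bicomplex vec \<Rightarrow> complex"
  assume lc: "bc.lincomb n a (set (cols A)) = \<zero>\<^bsub>bc_vec_space n\<^esub>"
  \<comment> \<open>The complex coefficients, embedded as bicomplex numbers, form a vector whose
    product with \<open>A\<close> is the given linear combination.\<close>
  define x where "x = vec n (\<lambda>j. bc_of_complex (a (col A j)))"
  have dist: "distinct (cols A)"
    by (rule distinct_cols_if_det_dvd_one[OF A unit])
  have "(A *\<^sub>v x) $ i = 0" if i: "i < n" for i
  proof -
    have "(A *\<^sub>v x) $ i = (\<Sum>j<n. bc_of_complex (a (col A j)) * col A j $ i)"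
      using A i by (simp add: x_def scalar_prod_def atLeast0LessThan mult.commute)
    also have "\<dots> = (\<Sum>v\<in>set (cols A). bc_of_complex (a v) * v $ i)"
    proof (rule sum.reindex_cong[symmetric])
      show "inj_on (col A) {..<n}"
        using dist A by (auto simp: inj_on_def distinct_conv_nth)
      show "set (cols A) = col A ` {..<n}"
        using A by (auto simp: cols_def)
    qed simp
    also have "\<dots> = bc.lincomb n a (set (cols A)) $ i"
      using carr i by (intro bc_lincomb_index[symmetric]) auto
    finally show ?thesis
      using lc i by simp
  qed
  then have "A *\<^sub>v x = 0\<^sub>v n"
    using A by (intro eq_vecI) auto
  moreover have "x \<in> carrier_vec n"
    by (simp add: x_def)
  ultimately have x0: "x = 0\<^sub>v n"
    using mult_mat_vec_eq_zero_imp_zero[OF A unit] by blast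
  have "a (col A j) = 0" if "j < n" for j
  proof -
    have "bc_of_complex (a (col A j)) = 0"
      using arg_cong[OF x0, of "\<lambda>v. v $ j"] that by (simp add: x_def)
    then show ?thesis
      by (simp add: bc_of_complex_def zero_bicomplex_def)
  qed
  then show "\<forall>v\<in>set (cols A). a v = \<zero>\<^bsub>class_ring\<^esub>"
    using A by (auto simp: cols_def)
qed simp

lemma col_rank_full:
  assumes A: "A \<in> carrier_mat n n" and unit: "det A dvd 1"
  shows "col_rank A = n"
proof -
  let ?S = "set (cols A)"
  \<comment> \<open>Being independent, \<open>?S\<close> is its own maximal independent subset, so
    its cardinality is the dimension of its span.\<close>
  have "maximal ?S (\<lambda>T. T \<subseteq> ?S \<and> bc.lin_indpt n T)"
    using bc_lin_indpt_cols[OF A unit] by (auto simp: maximal_def)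
  moreover have "?S \<subseteq> carrier (bc_vec_space n)"
    using A cols_dim[of A] by auto
  ultimately have "bc_span_dim n ?S = card ?S"
    unfolding bc_span_dim_def by (intro bc.dim_span) auto
  also have "\<dots> = n"
    using distinct_card[OF distinct_cols_if_det_dvd_one[OF A unit]] A by simp
  finally show ?thesis
    using A by (simp add: col_rank_def)
qed

lemma row_rank_conv_col_rank: "row_rank A = col_rank (transpose_mat A)"
  by (simp add: row_rank_def col_rank_def)

theorem proposition2p37:
  fixes A :: "bicomplex mat" and n :: nat
  assumes "A \<in> carrier_mat n n"
    and "bc_rank A = n"
  shows "bc_rank A = col_rank A \<and> col_rank A = row_rank A"
proof -
  have unit: "det A dvd 1"
    by (rule bc_rank_full_imp_det_dvd_one[OF assms])
  then have "det (transpose_mat A) dvd 1"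
    using det_transpose[OF assms(1)] by simp
  then have "row_rank A = n"
    using assms(1) by (simp add: row_rank_conv_col_rank col_rank_full)
  with col_rank_full[OF assms(1) unit] assms(2) show ?thesis
    by simp
qed

end
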